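(* Let $(A,\tau_\lambda^A,\alpha_A,\beta_A)$ be a BiHom-associative conformal algebra and let $(M,l_\lambda,r_\lambda,\alpha_M,\beta_M)$ be a conformal $A$-bimodule. Let $H_\lambda:A\otimes A\to M[\lambda]$ be a Hochschild $2$-cocycle and let $R:M\to A$ be an $H$-twisted Rota-Baxter operator. Define operations on $M$ by $m\succ_\lambda n=R(m)_\lambda n$, $m\prec_\lambda n=m_\lambda R(n)$ and $m\vee_\lambda n=H_\lambda(R(m),R(n))$ for all $m,n\in M$. Then $(M,\prec_\lambda,\succ_\lambda,\vee_\lambda,\alpha_M,\beta_M)$ is a BiHom-NS-conformal algebra.
   Context: All vector spaces, linear maps and tensor products are over $\mathbb{C}$, and $V[\lambda]=\mathbb{C}[\lambda]\otimes V$ for a $\mathbb{C}[\partial]$-module $V$. A $\mathbb{C}$-bilinear map $U\otimes V\to W[\lambda]$, $u\otimes v\mapsto u\circ_\lambda v$, is conformal sesquilinear if $(\partial u)\circ_\lambda v=-\lambda(u\circ_\lambda v)$ and $u\circ_\lambda(\partial v)=(\partial+\lambda)(u\circ_\lambda v)$. Linear maps and products are extended coefficientwise to polynomials in $\lambda,\mu$. A BiHom-associative conformal algebra $(A,\tau_\lambda,\alpha,\beta)$ is a $\mathbb{C}[\partial]$-module $A$ with a conformal sesquilinear map $\tau_\lambda:A\otimes A\to A[\lambda]$, $p\otimes q\mapsto p_\lambda q$, and commuting $\mathbb{C}$-linear maps $\alpha,\beta:A\to A$ with $\alpha\partial=\partial\alpha$ and $\beta\partial=\partial\beta$, such that $\alpha(p_\lambda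 q)=\alpha(p)_\lambda\alpha(q)$, $\beta(p_\lambda q)=\beta(p)_\lambda\beta(q)$ and $\alpha(p)_\lambda(q_\mu r)=(p_\lambda q)_{\lambda+\mu}\beta(r)$ for all $p,q,r\in A$. A conformal bimodule $(M,l_\lambda,r_\lambda,\alpha_M,\beta_M)$ over $(A,\tau_\lambda^A,\alpha_A,\beta_A)$ is a $\mathbb{C}[\partial]$-module $M$ with commuting $\mathbb{C}$-linear maps $\alpha_M,\beta_M:M\to M$ and conformal sesquilinear maps $l_\lambda:A\otimes M\to M[\lambda]$, $p\otimes m\mapsto p_\lambda m$, and $r_\lambda:M\otimes A\to M[\lambda]$, $m\otimes p\mapsto m_\lambda p$, such that for all $p,q\in A$, $m\in M$: $\alpha_M(p_\lambda m)=\alpha_A(p)_\lambda\alpha_M(m)$; $\beta_M(p_\lambda m)=\beta_A(p)_\lambda\beta_M(m)$; $(m_\lambda p)_{\lambda+\mu}\beta_A(q)=\alpha_M(m)_\lambda(p_\mu q)$; $(p_\lambda q)_{\lambda+\mu}\beta_M(m)=\alpha_A(p)_\lambda(q_\mu m)$; $(p_\lambda m)_{\lambda+\mu}\beta_A(q)=\alpha_A(p)_\lambda(m_\mu q)$. A Hochschild $2$-cocycle on $A$ with coefficients in $M$ is a skew symmetric bilinear map $H_\lambda:A\otimes A\to M[\lambda]$ such that $H_\lambda\circ(\alpha_A\otimes\alpha_A)=\alpha_M\circ H_\lambda$, $H_\lambda\circ(\beta_A\otimes\beta_A)=\beta_M\circ H_\lambda$ and $\alpha_A(p)_\lambda H_\mu(q,r)-H_{\lambda+\mu}(p_\lambda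 q,\beta_A(r))+H_\lambda(\alpha_A(p),q_\mu r)-H_\lambda(p,q)_{\lambda+\mu}\beta_A(r)=0$ for all $p,q,r\in A$. For such an $H$, an $H$-twisted Rota-Baxter operator is a linear map $R:M\to A$ with $R\circ\alpha_M=\alpha_A\circ R$, $R\circ\beta_M=\beta_A\circ R$ and $R(m)_\lambda R(n)=R(m_\lambda R(n)+R(m)_\lambda n+H_\lambda(R(m),R(n)))$ for all $m,n\in M$. A BiHom-NS-conformal algebra $(B,\prec_\lambda,\succ_\lambda,\vee_\lambda,\alpha,\beta)$ is a $\mathbb{C}[\partial]$-module $B$ with three conformal sesquilinear maps $\prec_\lambda,\succ_\lambda,\vee_\lambda:B\otimes B\to B[\lambda]$ and two commuting linear maps $\alpha,\beta:B\to B$, each multiplicative for all three products (i.e. $\alpha(p\circ_\lambda q)=\alpha(p)\circ_\lambda\alpha(q)$ and $\beta(p\circ_\lambda q)=\beta(p)\circ_\lambda\beta(q)$ for $\circ\in\{\prec,\succ,\vee\}$), such that, with $p*_\lambda q=p\prec_\lambda q+p\succ_\lambda q+p\vee_\lambda q$, for all $p,q,r\in B$: $(p\prec_\lambda q)\prec_{\lambda+\mu}\beta(r)=\alpha(p)\prec_\lambda(q*_\mu r)$; $(p\succ_\lambda q)\prec_{\lambda+\mu}\beta(r)=\alpha(p)\succ_\lambda(q\prec_\mu r)$; $(p*_\lambda q)\succ_{\lambda+\mu}\beta(r)=\alpha(p)\succ_\lambda(q\succ_\mu r)$; $(p\vee_\lambda q)\prec_{\lambda+\mu}\beta(r)+(p*_\lambda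 q)\vee_{\lambda+\mu}\beta(r)=\alpha(p)\succ_\lambda(q\vee_\mu r)+\alpha(p)\vee_\lambda(q*_\mu r)$.
   Formalization: Added so that the claim holds: α_M and β_M are also multiplicative for the right action m_λ p; R is ℂ[∂]-linear, not just ℂ-linear; H is conformal sesquilinear, not just bilinear, and its skew symmetry is the conformal one, H_λ(p,q) = -H_{-λ-∂}(q,p). *)

theory Defs
  imports Complex_Main "HOL-Computational_Algebra.Polynomial"
begin

text \<open>
  A \<open>\<complex>[\<partial>]\<close>-module is an abelian group type \<open>'v\<close> with a scalar multiplication
  \<open>s :: complex poly \<Rightarrow> 'v \<Rightarrow> 'v\<close> satisfying the library locale \<open>module s\<close>; the polynomial
  indeterminate plays the role of \<open>\<partial>\<close>.  The space \<open>V[\<lambda>]\<close> is \<open>'v poly\<close>, and \<open>V[\<lambda>, \<mu>]\<close> is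
  \<open>'v poly poly\<close> with \<open>\<mu>\<close> as the outer and \<open>\<lambda>\<close> as the inner indeterminate.  A map
  \<open>f :: 'u \<Rightarrow> 'v \<Rightarrow> 'w poly\<close> stands for \<open>u \<otimes> v \<mapsto> f\<^sub>\<lambda>(u, v)\<close>, and the coefficientwise extension
  of a linear map is \<open>map_poly\<close>.
\<close>

definition cscale :: "(complex poly \<Rightarrow> 'v \<Rightarrow> 'v) \<Rightarrow> complex \<Rightarrow> 'v \<Rightarrow> 'v" where
  "cscale s c v = s [:c:] v"

definition del :: "(complex poly \<Rightarrow> 'v \<Rightarrow> 'v) \<Rightarrow> 'v \<Rightarrow> 'v" where
  "del s v = s [:0, 1:] v"

abbreviation clinear ::
  "(complex poly \<Rightarrow> 'u \<Rightarrow> 'u) \<Rightarrow> (complex poly \<Rightarrow> 'v \<Rightarrow> 'v)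
    \<Rightarrow> ('u::ab_group_add \<Rightarrow> 'v::ab_group_add) \<Rightarrow> bool" where
  "clinear s t \<equiv> Vector_Spaces.linear (cscale s) (cscale t)"

definition cbilinear_poly ::
  "(complex poly \<Rightarrow> 'u \<Rightarrow> 'u) \<Rightarrow> (complex poly \<Rightarrow> 'v \<Rightarrow> 'v) \<Rightarrow> (complex poly \<Rightarrow> 'w \<Rightarrow> 'w)
    \<Rightarrow> ('u::ab_group_add \<Rightarrow> 'v::ab_group_add \<Rightarrow> 'w::ab_group_add poly) \<Rightarrow> bool" where
  "cbilinear_poly s t w f \<longleftrightarrow>
     (\<forall>u. Vector_Spaces.linear (cscale t) (\<lambda>c. map_poly (cscale w c)) (\<lambda>v. f u v)) \<and>
     (\<forall>v. Vector_Spaces.linear (cscale s) (\<lambda>c. map_poly (cscale w c)) (\<lambda>u. f u v))"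

definition conformal_sesquilinear ::
  "(complex poly \<Rightarrow> 'u \<Rightarrow> 'u) \<Rightarrow> (complex poly \<Rightarrow> 'v \<Rightarrow> 'v) \<Rightarrow> (complex poly \<Rightarrow> 'w \<Rightarrow> 'w)
    \<Rightarrow> ('u::ab_group_add \<Rightarrow> 'v::ab_group_add \<Rightarrow> 'w::ab_group_add poly) \<Rightarrow> bool" where
  "conformal_sesquilinear s t w f \<longleftrightarrow>
     cbilinear_poly s t w f \<and>
     (\<forall>u v. f (del s u) v = - pCons 0 (f u v)) \<and>
     (\<forall>u v. f u (del t v) = map_poly (del w) (f u v) + pCons 0 (f u v))"

text \<open>
  Substitution into \<open>P = \<Sum>\<^sub>k c\<^sub>k x\<^sup>k\<close>: the indeterminate acts as the operator \<open>T\<close> and the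
  coefficient \<open>c\<close> is sent to \<open>g c\<close>, giving \<open>\<Sum>\<^sub>k T\<^sup>k (g c\<^sub>k)\<close>.
\<close>
definition subst_poly :: "('w \<Rightarrow> 'w) \<Rightarrow> ('v::zero \<Rightarrow> 'w::ab_group_add) \<Rightarrow> 'v poly \<Rightarrow> 'w" where
  "subst_poly T g P = (\<Sum>k\<le>degree P. (T ^^ k) (g (coeff P k)))"

definition mul_lambda :: "'v::ab_group_add poly poly \<Rightarrow> 'v poly poly" where
  "mul_lambda = map_poly (pCons 0)"

definition mul_mu :: "'v::ab_group_add poly poly \<Rightarrow> 'v poly poly" where
  "mul_mu = pCons 0"

text \<open>\<open>at_sum P\<close> is \<open>P\<close> with its variable replaced by \<open>\<lambda> + \<mu>\<close>.\<close>
definition at_sum :: "'v::ab_group_add poly \<Rightarrow> 'v poly poly" where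
  "at_sum = subst_poly (\<lambda>Q. mul_lambda Q + mul_mu Q) (\<lambda>v. [:[:v:]:])"

text \<open>
  The two iterated products: \<open>left_iter f g u v w = g\<^bsub>\<lambda>+\<mu>\<^esub>(f\<^sub>\<lambda>(u, v), w)\<close> and
  \<open>right_iter f g u v w = g\<^sub>\<lambda>(u, f\<^sub>\<mu>(v, w))\<close>.
\<close>
definition left_iter ::
  "('u \<Rightarrow> 'v \<Rightarrow> 'x::zero poly) \<Rightarrow> ('x \<Rightarrow> 'w \<Rightarrow> 'y::ab_group_add poly)
    \<Rightarrow> 'u \<Rightarrow> 'v \<Rightarrow> 'w \<Rightarrow> 'y poly poly" where
  "left_iter f g u v w = subst_poly mul_lambda (\<lambda>x. at_sum (g x w)) (f u v)"

definition right_iter ::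
  "('v \<Rightarrow> 'w \<Rightarrow> 'x::zero poly) \<Rightarrow> ('u \<Rightarrow> 'x \<Rightarrow> 'y::ab_group_add poly)
    \<Rightarrow> 'u \<Rightarrow> 'v \<Rightarrow> 'w \<Rightarrow> 'y poly poly" where
  "right_iter f g u v w = map_poly (g u) (f v w)"

text \<open>Skew symmetry in the conformal sense: \<open>f\<^sub>\<lambda>(u, v) = - f\<^bsub>-\<lambda>-\<partial>\<^esub>(v, u)\<close>.\<close>
definition conformal_skew ::
  "(complex poly \<Rightarrow> 'w \<Rightarrow> 'w) \<Rightarrow> ('u \<Rightarrow> 'u \<Rightarrow> 'w::ab_group_add poly) \<Rightarrow> bool" where
  "conformal_skew w f \<longleftrightarrow>
     (\<forall>u v. f u v =
        - subst_poly (\<lambda>Q. - pCons 0 Q - map_poly (del w) Q) (\<lambda>x. [:x:]) (f v u))"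

locale bihom_assoc_conformal =
  module s for s :: "complex poly \<Rightarrow> 'a::ab_group_add \<Rightarrow> 'a" +
  fixes mul :: "'a \<Rightarrow> 'a \<Rightarrow> 'a poly"
    and \<alpha> \<beta> :: "'a \<Rightarrow> 'a"
  assumes sesquilinear: "conformal_sesquilinear s s s mul"
    and alpha_linear: "clinear s s \<alpha>"
    and beta_linear: "clinear s s \<beta>"
    and alpha_beta_commute: "\<alpha> (\<beta> p) = \<beta> (\<alpha> p)"
    and alpha_del: "\<alpha> (del s p) = del s (\<alpha> p)"
    and beta_del: "\<beta> (del s p) = del s (\<beta> p)"
    and alpha_mult: "map_poly \<alpha> (mul p q) = mul (\<alpha> p) (\<alpha> q)"
    and beta_mult: "map_poly \<beta> (mul p q) = mul (\<beta> p) (\<beta> q)"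
    and bihom_assoc: "right_iter mul mul (\<alpha> p) q r = left_iter mul mul p q (\<beta> r)"

text \<open>
  The axioms \<open>alpha_right\<close> and \<open>beta_right\<close> are the right-hand counterparts of \<open>alpha_left\<close> and
  \<open>beta_left\<close>.  Some presentations list only the left-hand pair, but the right-hand pair does not
  follow from the other axioms.
\<close>
locale conformal_bimodule =
  A: bihom_assoc_conformal sA mulA \<alpha>A \<beta>A + M: module sM
  for sA :: "complex poly \<Rightarrow> 'a::ab_group_add \<Rightarrow> 'a" and mulA \<alpha>A \<beta>A
    and sM :: "complex poly \<Rightarrow> 'm::ab_group_add \<Rightarrow> 'm" +
  fixes l :: "'a \<Rightarrow> 'm \<Rightarrow> 'm poly"
    and r :: "'m \<Rightarrow> 'a \<Rightarrow> 'm poly"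
    and \<alpha>M \<beta>M :: "'m \<Rightarrow> 'm"
  assumes left_sesquilinear: "conformal_sesquilinear sA sM sM l"
    and right_sesquilinear: "conformal_sesquilinear sM sA sM r"
    and alphaM_linear: "clinear sM sM \<alpha>M"
    and betaM_linear: "clinear sM sM \<beta>M"
    and alphaM_betaM_commute: "\<alpha>M (\<beta>M m) = \<beta>M (\<alpha>M m)"
    and alpha_left: "map_poly \<alpha>M (l p m) = l (\<alpha>A p) (\<alpha>M m)"
    and beta_left: "map_poly \<beta>M (l p m) = l (\<beta>A p) (\<beta>M m)"
    and alpha_right: "map_poly \<alpha>M (r m p) = r (\<alpha>M m) (\<alpha>A p)"
    and beta_right: "map_poly \<beta>M (r m p) = r (\<beta>M m) (\<beta>A p)"
    and right_right: "left_iter r r m p (\<beta>A q) = right_iter mulA r (\<alpha>M m) p q"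
    and left_left: "left_iter mulA l p q (\<beta>M m) = right_iter l l (\<alpha>A p) q m"
    and left_right: "left_iter l r p m (\<beta>A q) = right_iter r l (\<alpha>A p) m q"

text \<open>
  Bilinearity of a cochain with values in \<open>M[\<lambda>]\<close> is meant in the conformal sense, that is,
  cochains are conformal sesquilinear.
\<close>
locale hochschild_2_cocycle =
  conformal_bimodule sA mulA \<alpha>A \<beta>A sM l r \<alpha>M \<beta>M
  for sA :: "complex poly \<Rightarrow> 'a::ab_group_add \<Rightarrow> 'a" and mulA \<alpha>A \<beta>A
    and sM :: "complex poly \<Rightarrow> 'm::ab_group_add \<Rightarrow> 'm" and l r \<alpha>M \<beta>M +
  fixes H :: "'a \<Rightarrow> 'a \<Rightarrow> 'm poly"
  assumes H_sesquilinear: "conformal_sesquilinear sA sA sM H"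
    and H_skew: "conformal_skew sM H"
    and H_alpha: "H (\<alpha>A p) (\<alpha>A q) = map_poly \<alpha>M (H p q)"
    and H_beta: "H (\<beta>A p) (\<beta>A q) = map_poly \<beta>M (H p q)"
    and H_cocycle:
      "right_iter H l (\<alpha>A p) q t - left_iter mulA H p q (\<beta>A t)
        + right_iter mulA H (\<alpha>A p) q t - left_iter H r p q (\<beta>A t) = 0"

text \<open>A linear map between \<open>\<complex>[\<partial>]\<close>-modules such as \<open>R\<close> is required to be \<open>\<complex>[\<partial>]\<close>-linear.\<close>
locale twisted_rota_baxter =
  hochschild_2_cocycle sA mulA \<alpha>A \<beta>A sM l r \<alpha>M \<beta>M H
  for sA :: "complex poly \<Rightarrow> 'a::ab_group_add \<Rightarrow> 'a" and mulA \<alpha>A \<beta>A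
    and sM :: "complex poly \<Rightarrow> 'm::ab_group_add \<Rightarrow> 'm" and l r \<alpha>M \<beta>M H +
  fixes R :: "'m \<Rightarrow> 'a"
  assumes R_linear: "module_hom sM sA R"
    and R_alpha: "R (\<alpha>M m) = \<alpha>A (R m)"
    and R_beta: "R (\<beta>M m) = \<beta>A (R m)"
    and rota_baxter:
      "mulA (R m) (R n) = map_poly R (r m (R n) + l (R m) n + H (R m) (R n))"

locale bihom_NS_conformal =
  module s for s :: "complex poly \<Rightarrow> 'b::ab_group_add \<Rightarrow> 'b" +
  fixes prec succ vee :: "'b \<Rightarrow> 'b \<Rightarrow> 'b poly"
    and \<alpha> \<beta> :: "'b \<Rightarrow> 'b"
  fixes star :: "'b \<Rightarrow> 'b \<Rightarrow> 'b poly"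
  defines "star \<equiv> \<lambda>p q. prec p q + succ p q + vee p q"
  assumes prec_sesquilinear: "conformal_sesquilinear s s s prec"
    and succ_sesquilinear: "conformal_sesquilinear s s s succ"
    and vee_sesquilinear: "conformal_sesquilinear s s s vee"
    and alpha_linear: "clinear s s \<alpha>"
    and beta_linear: "clinear s s \<beta>"
    and alpha_beta_commute: "\<alpha> (\<beta> p) = \<beta> (\<alpha> p)"
    and alpha_prec: "map_poly \<alpha> (prec p q) = prec (\<alpha> p) (\<alpha> q)"
    and alpha_succ: "map_poly \<alpha> (succ p q) = succ (\<alpha> p) (\<alpha> q)"
    and alpha_vee: "map_poly \<alpha> (vee p q) = vee (\<alpha> p) (\<alpha> q)"
    and beta_prec: "map_poly \<beta> (prec p q) = prec (\<beta> p) (\<beta> q)"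
    and beta_succ: "map_poly \<beta> (succ p q) = succ (\<beta> p) (\<beta> q)"
    and beta_vee: "map_poly \<beta> (vee p q) = vee (\<beta> p) (\<beta> q)"
    and NS1: "left_iter prec prec p q (\<beta> r) = right_iter star prec (\<alpha> p) q r"
    and NS2: "left_iter succ prec p q (\<beta> r) = right_iter prec succ (\<alpha> p) q r"
    and NS3: "left_iter star succ p q (\<beta> r) = right_iter succ succ (\<alpha> p) q r"
    and NS4: "left_iter vee prec p q (\<beta> r) + left_iter star vee p q (\<beta> r)
                = right_iter vee succ (\<alpha> p) q r + right_iter star vee (\<alpha> p) q r"

end

theory Submission
  imports Defs
begin

text \<open>
  Write \<open>p * q\<close> for the sum of the three products on \<open>M\<close>.  The twisted Rota-Baxter identity says
  precisely that \<open>R\<close> carries \<open>*\<close> to the multiplication of \<open>A\<close>.  Hence the product of \<open>A\<close>, where it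
  enters a bimodule axiom or the cocycle condition evaluated at \<open>R p\<close>, \<open>R q\<close>, \<open>R t\<close>, may be
  replaced by \<open>*\<close>, and \<open>R\<close> moved into the outer map.  After this exchange the first three
  NS-identities are the three bimodule associativity laws \<open>right_right\<close>, \<open>left_right\<close> and
  \<open>left_left\<close>, and the fourth is the cocycle condition with its negative terms moved to
  the other side; \<open>R\<close> intertwines the structure maps, so \<open>\<alpha>M\<close> and \<open>\<beta>M\<close> on \<open>M\<close> become \<open>\<alpha>A\<close> and \<open>\<beta>A\<close>
  on \<open>A\<close>.

  Moving \<open>R\<close> into the outer map is naturality of the iterated products in their
  intermediate value (\<open>left_iter_natural\<close>, \<open>right_iter_natural\<close>).  That the new products are conformal
  sesquilinear is stability under \<open>\<complex>[\<partial>]\<close>-linear pullback (\<open>conformal_sesquilinear_pullback\<close>).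
\<close>

text \<open>
  The constant polynomials embed \<open>\<complex>\<close> as a subring of \<open>\<complex>[\<partial>]\<close>, so restriction of scalars turns a
  module over the latter into a vector space.
\<close>
lemma vector_space_cscale:
  assumes "module s"
  shows "vector_space (cscale s)"
proof -
  interpret module s by fact
  have add: "s [:a + b:] x = s [:a:] x + s [:b:] x" for a b x
    using scale_left_distrib[of "[:a:]" "[:b:]" x] by simp
  have mult: "s [:a:] (s [:b:] x) = s [:a * b:] x" for a b x
    using scale_scale[of "[:a:]" "[:b:]" x] by (simp add: mult.commute)
  show ?thesis
    by unfold_locales
      (simp_all add: cscale_def add mult scale_right_distrib mult.commute flip: one_pCons)
qed

lemma module_hom_imp_clinear:
  assumes "module_hom s t f"
  shows "clinear s t f"
proof -
  interpret module_hom s t f by fact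
  interpret S: vector_space "cscale s" by (rule vector_space_cscale) unfold_locales
  interpret T: vector_space "cscale t" by (rule vector_space_cscale) unfold_locales
  show ?thesis by unfold_locales (simp_all add: cscale_def add scale)
qed

lemma module_hom_del:
  assumes "module_hom s t f"
  shows "f (del s v) = del t (f v)"
  unfolding del_def by (rule module_hom.scale[OF assms])

lemma conformal_sesquilinear_pullback:
  assumes f: "conformal_sesquilinear s t w f"
    and g: "module_hom s' s g" and h: "module_hom t' t h"
  shows "conformal_sesquilinear s' t' w (\<lambda>u v. f (g u) (h v))"
proof -
  have "Vector_Spaces.linear (cscale t') (\<lambda>c. map_poly (cscale w c)) (\<lambda>v. f (g u) (h v))" for u
    using Vector_Spaces.linear_compose[OF module_hom_imp_clinear[OF h], of _ "f (g u)"] f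
    by (simp add: conformal_sesquilinear_def cbilinear_poly_def comp_def)
  moreover
  have "Vector_Spaces.linear (cscale s') (\<lambda>c. map_poly (cscale w c)) (\<lambda>u. f (g u) (h v))" for v
    using Vector_Spaces.linear_compose[OF module_hom_imp_clinear[OF g], of _ "\<lambda>x. f x (h v)"] f
    by (simp add: conformal_sesquilinear_def cbilinear_poly_def comp_def)
  ultimately show ?thesis
    using f by (simp add: conformal_sesquilinear_def cbilinear_poly_def
        module_hom_del[OF g] module_hom_del[OF h])
qed

lemma conformal_sesquilinear_0_left:
  assumes "conformal_sesquilinear s t w f"
  shows "f 0 v = 0"
proof -
  have "Vector_Spaces.linear (cscale s) (\<lambda>c. map_poly (cscale w c)) (\<lambda>u. f u v)"
    using assms by (simp add: conformal_sesquilinear_def cbilinear_poly_def)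
  then show ?thesis by (rule module_hom.zero[OF Vector_Spaces.linear.axioms(3)])
qed

lemma conformal_sesquilinear_0_right:
  assumes "conformal_sesquilinear s t w f"
  shows "f u 0 = 0"
proof -
  have "Vector_Spaces.linear (cscale t) (\<lambda>c. map_poly (cscale w c)) (f u)"
    using assms by (simp add: conformal_sesquilinear_def cbilinear_poly_def)
  then show ?thesis by (rule module_hom.zero[OF Vector_Spaces.linear.axioms(3)])
qed

text \<open>
  Applying \<open>\<phi>\<close> to the coefficients may lower the degree, and with it the range of summation in
  \<open>subst_poly\<close>; the hypotheses at \<open>0\<close> make the lost summands vanish.
\<close>
lemma subst_poly_map_poly:
  assumes T: "T 0 = 0" and g: "g 0 = 0" and \<phi>: "\<phi> 0 = 0"
  shows "subst_poly T g (map_poly \<phi> P) = subst_poly T (\<lambda>x. g (\<phi> x)) P"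
proof -
  have T0: "(T ^^ k) 0 = 0" for k
    by (induction k) (simp_all add: T)
  have "subst_poly T g (map_poly \<phi> P) =
      (\<Sum>k\<le>degree (map_poly \<phi> P). (T ^^ k) (g (\<phi> (coeff P k))))"
    by (simp add: subst_poly_def coeff_map_poly \<phi>)
  also have "\<dots> = (\<Sum>k\<le>degree P. (T ^^ k) (g (\<phi> (coeff P k))))"
  proof (rule sum.mono_neutral_left)
    show "{..degree (map_poly \<phi> P)} \<subseteq> {..degree P}"
      using map_poly_degree_leq[of \<phi> P] by auto
    show "\<forall>k\<in>{..degree P} - {..degree (map_poly \<phi> P)}. (T ^^ k) (g (\<phi> (coeff P k))) = 0"
    proof
      fix k assume "k \<in> {..degree P} - {..degree (map_poly \<phi> P)}"
      then have "coeff (map_poly \<phi> P) k = 0" by (simp add: coeff_eq_0)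
      then show "(T ^^ k) (g (\<phi> (coeff P k))) = 0" by (simp add: coeff_map_poly \<phi> g T0)
    qed
  qed simp
  finally show ?thesis by (simp add: subst_poly_def)
qed

lemma left_iter_natural:
  assumes f: "f' u' v' = map_poly \<phi> (f u v)" and \<phi>: "\<phi> 0 = 0" and g: "g 0 w = 0"
  shows "left_iter f' g u' v' w = left_iter f (\<lambda>x. g (\<phi> x)) u v w"
proof -
  have "at_sum (g 0 w) = 0" by (simp add: g at_sum_def subst_poly_def)
  moreover have "mul_lambda 0 = 0" by (simp add: mul_lambda_def)
  ultimately show ?thesis unfolding left_iter_def f by (intro subst_poly_map_poly \<phi>)
qed

lemma right_iter_natural:
  assumes f: "f' v' w' = map_poly \<phi> (f v w)" and \<phi>: "\<phi> 0 = 0" and g: "g u 0 = 0"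
  shows "right_iter f' g u v' w' = right_iter f (\<lambda>u x. g u (\<phi> x)) u v w"
  by (simp add: right_iter_def f map_poly_map_poly \<phi> g comp_def)

theorem proposition3p9:
  fixes sA :: "complex poly \<Rightarrow> 'a::ab_group_add \<Rightarrow> 'a"
    and mulA :: "'a \<Rightarrow> 'a \<Rightarrow> 'a poly"
    and \<alpha>A \<beta>A :: "'a \<Rightarrow> 'a"
    and sM :: "complex poly \<Rightarrow> 'm::ab_group_add \<Rightarrow> 'm"
    and l :: "'a \<Rightarrow> 'm \<Rightarrow> 'm poly"
    and r :: "'m \<Rightarrow> 'a \<Rightarrow> 'm poly"
    and \<alpha>M \<beta>M :: "'m \<Rightarrow> 'm"
    and H :: "'a \<Rightarrow> 'a \<Rightarrow> 'm poly"
    and R :: "'m \<Rightarrow> 'a"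
  assumes "bihom_assoc_conformal sA mulA \<alpha>A \<beta>A"
    and "conformal_bimodule sA mulA \<alpha>A \<beta>A sM l r \<alpha>M \<beta>M"
    and "hochschild_2_cocycle sA mulA \<alpha>A \<beta>A sM l r \<alpha>M \<beta>M H"
    and "twisted_rota_baxter sA mulA \<alpha>A \<beta>A sM l r \<alpha>M \<beta>M H R"
  shows "bihom_NS_conformal sM
           (\<lambda>m n. r m (R n)) (\<lambda>m n. l (R m) n) (\<lambda>m n. H (R m) (R n)) \<alpha>M \<beta>M"
proof -
  interpret twisted_rota_baxter sA mulA \<alpha>A \<beta>A sM l r \<alpha>M \<beta>M H R by fact
  have id: "module_hom sM sM (\<lambda>x. x)"
    by (rule M.module_hom_ident)
  have R0: "R 0 = 0" by (rule module_hom.zero[OF R_linear])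
  let ?star = "\<lambda>m n. r m (R n) + l (R m) n + H (R m) (R n)"
  have NS1: "left_iter (\<lambda>m n. r m (R n)) (\<lambda>m n. r m (R n)) p q (\<beta>M t)
      = right_iter ?star (\<lambda>m n. r m (R n)) (\<alpha>M p) q t" for p q t
  proof -
    have "left_iter (\<lambda>m n. r m (R n)) (\<lambda>m n. r m (R n)) p q (\<beta>M t) = left_iter r r p (R q) (\<beta>A (R t))"
      by (simp add: left_iter_def R_beta)
    also have "\<dots> = right_iter mulA r (\<alpha>M p) (R q) (R t)" by (rule right_right)
    also have "\<dots> = right_iter ?star (\<lambda>m n. r m (R n)) (\<alpha>M p) q t"
      using rota_baxter R0 conformal_sesquilinear_0_right[OF right_sesquilinear]
      by (rule right_iter_natural)
    finally show ?thesis .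
  qed
  have NS2: "left_iter (\<lambda>m n. l (R m) n) (\<lambda>m n. r m (R n)) p q (\<beta>M t)
      = right_iter (\<lambda>m n. r m (R n)) (\<lambda>m n. l (R m) n) (\<alpha>M p) q t" for p q t
    using left_right[of "R p" q "R t"] by (simp add: left_iter_def right_iter_def R_alpha R_beta)
  have NS3: "left_iter ?star (\<lambda>m n. l (R m) n) p q (\<beta>M t)
      = right_iter (\<lambda>m n. l (R m) n) (\<lambda>m n. l (R m) n) (\<alpha>M p) q t" for p q t
  proof -
    have "left_iter ?star (\<lambda>m n. l (R m) n) p q (\<beta>M t) = left_iter mulA l (R p) (R q) (\<beta>M t)"
      using rota_baxter R0 conformal_sesquilinear_0_left[OF left_sesquilinear]
      by (rule left_iter_natural[symmetric])
    also have "\<dots> = right_iter l l (\<alpha>A (R p)) (R q) t" by (rule left_left)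
    finally show ?thesis by (simp add: right_iter_def R_alpha)
  qed
  have NS4: "left_iter (\<lambda>m n. H (R m) (R n)) (\<lambda>m n. r m (R n)) p q (\<beta>M t)
        + left_iter ?star (\<lambda>m n. H (R m) (R n)) p q (\<beta>M t)
      = right_iter (\<lambda>m n. H (R m) (R n)) (\<lambda>m n. l (R m) n) (\<alpha>M p) q t
        + right_iter ?star (\<lambda>m n. H (R m) (R n)) (\<alpha>M p) q t" for p q t
  proof -
    have "left_iter mulA H (R p) (R q) (\<beta>A (R t))
        = left_iter ?star (\<lambda>m. H (R m)) p q (\<beta>A (R t))"
      using rota_baxter R0 conformal_sesquilinear_0_left[OF H_sesquilinear]
      by (rule left_iter_natural)
    moreover have "right_iter mulA H (\<alpha>A (R p)) (R q) (R t)
        = right_iter ?star (\<lambda>a n. H a (R n)) (\<alpha>A (R p)) q t"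
      using rota_baxter R0 conformal_sesquilinear_0_right[OF H_sesquilinear]
      by (rule right_iter_natural)
    ultimately show ?thesis
      using H_cocycle[of "R p" "R q" "R t"]
      by (simp add: left_iter_def right_iter_def R_alpha R_beta algebra_simps)
  qed
  show ?thesis
  proof (intro bihom_NS_conformal.intro bihom_NS_conformal_axioms.intro, goal_cases)
    case 1 show ?case by (rule M.module_axioms)
  next
    case 2 show ?case by (rule conformal_sesquilinear_pullback[OF right_sesquilinear id R_linear])
  next
    case 3 show ?case by (rule conformal_sesquilinear_pullback[OF left_sesquilinear R_linear id])
  next
    case 4 show ?case by (rule conformal_sesquilinear_pullback[OF H_sesquilinear R_linear R_linear])
  qed (simp_all only: alphaM_linear betaM_linear alphaM_betaM_commute alpha_left beta_left alpha_right
      beta_right H_alpha[symmetric] H_beta[symmetric] R_alpha R_beta NS1 NS2 NS3 NS4)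
qed

end
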